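(* Let $\nu$ be a random variable with $\mathbf{P}(\nu=j)>0$ for all $j\in\mathbb{N}=\{1,2,\dots\}$ and $\sum_{j\ge1}\mathbf{P}(\nu=j)=1$, let $F(j)=\mathbf{P}(\nu\le j)$, $F(0)=0$, and let $\{X_n\}$ be the Lamperti maximal branching process with branching number $\nu$, i.e. the Markov chain on $\mathbb{N}$ with transition matrix $P(i,j)=F(j)^i-F(j-1)^i$, $i,j\ge1$. If $\{X_n\}$ is transient, then it has a non-trivial ($\ne\mathbf{0}$) invariant positive measure: there is $\mathbf{\delta}=(\delta(j))_{j\ge1}$ with $0<\delta(j)<\infty$ and $\delta(j)=\sum_{i\ge1}\delta(i)P(i,j)$ for all $j\ge1$.
   Context: The Lamperti maximal branching process is defined by $X_{n+1}=\max_{j=1,\dots,X_n}\nu_{j,n+1}$ where the $\nu_{j,n+1}$ are i.i.d. copies of $\nu$. *)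

theory Defs
  imports "HOL-Probability.Probability"
begin

text \<open>
  The maximal branching process started from \<open>x\<close>, driven by the offspring numbers
  \<open>N j n\<close> (individual \<open>j\<close>, generation \<open>n\<close>, both counted from 1). The unspecified value
  of \<open>Max {}\<close> is irrelevant: if \<open>x \<ge> 1\<close> and all \<open>N j n \<ge> 1\<close>, the process stays
  in \<open>{1..}\<close>.
\<close>

primrec lamperti :: "(nat \<Rightarrow> nat \<Rightarrow> 'a \<Rightarrow> nat) \<Rightarrow> nat \<Rightarrow> nat \<Rightarrow> 'a \<Rightarrow> nat" where
  "lamperti N x 0 \<omega> = x"
| "lamperti N x (Suc n) \<omega> = Max ((\<lambda>j. N j (Suc n) \<omega>) ` {1..lamperti N x n \<omega>})"

definition lamperti_matrix :: "(nat \<Rightarrow> real) \<Rightarrow> nat \<Rightarrow> nat \<Rightarrow> real" where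
  "lamperti_matrix F i j = F j ^ i - F (j - 1) ^ i"

definition iid_copies ::
  "'b measure \<Rightarrow> ('b \<Rightarrow> nat) \<Rightarrow> 'a measure \<Rightarrow> (nat \<Rightarrow> nat \<Rightarrow> 'a \<Rightarrow> nat) \<Rightarrow> bool" where
  "iid_copies \<Omega> \<nu> M N \<longleftrightarrow>
     prob_space.indep_vars M (\<lambda>_. count_space UNIV) (\<lambda>(j, n). N j n) ({1..} \<times> {1..}) \<and>
     (\<forall>j\<ge>1. \<forall>n\<ge>1. distr M (count_space UNIV) (N j n) = distr \<Omega> (count_space UNIV) \<nu>)"

text \<open>
  Here \<open>X i\<close> is the chain started from the state \<open>i\<close>. A chain with state space \<open>S\<close> is
  transient if from every state the probability of ever returning to it is less than 1.
\<close>

definition transient_chain ::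
  "'a measure \<Rightarrow> nat set \<Rightarrow> (nat \<Rightarrow> nat \<Rightarrow> 'a \<Rightarrow> nat) \<Rightarrow> bool" where
  "transient_chain M S X \<longleftrightarrow>
     (\<forall>i\<in>S. measure M {\<omega> \<in> space M. \<exists>n\<ge>1. X i n \<omega> = i} < 1)"

end

theory Submission
  imports Defs "HOL-Complex_Analysis.Great_Picard"
begin

text \<open>
  Transience makes the Green function \<open>G(k, j)\<close> finite. Since \<open>G(k, j) P(j, 1) \<le> G(k, 1)\<close>, the
  normalised rows \<open>G(k, \<cdot>) / G(k, 1)\<close> have a pointwise limit \<open>\<delta>\<close> along a subsequence of
  \<open>k \<rightarrow> \<infinity>\<close>. The defect \<open>[k = j]\<close> in \<open>G = I + G P\<close> disappears in the limit, and the sums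
  converge to the right value because \<open>P(i, j) / P(i, j + 1) \<rightarrow> 0\<close> as \<open>i \<rightarrow> \<infinity>\<close>: the tail of
  \<open>\<Sum>i. G(k, i) P(i, j)\<close> is at most \<open>\<epsilon> G(k, j + 1)\<close>, uniformly in \<open>k\<close>.
  State \<open>n\<close> of the abstract kernels on \<open>nat\<close> corresponds to state \<open>n + 1\<close> of the Lamperti chain.
\<close>

section \<open>Limits of normalised Green function rows\<close>

lemma invariant_measure_of_green_function:
  fixes K G :: "nat \<Rightarrow> nat \<Rightarrow> real"
  assumes K_pos: "\<And>i j. K i j > 0" and G_nonneg: "\<And>i j. G i j \<ge> 0"
    and green: "\<And>k j. (\<lambda>i. G k i * K i j) sums (G k j - of_bool (k = j))"
    and ratio: "\<And>j. (\<lambda>i. K i j / K i (Suc j)) \<longlonglongrightarrow> 0"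
  obtains \<delta> :: "nat \<Rightarrow> real" where "\<And>j. \<delta> j > 0" "\<And>j. (\<lambda>i. \<delta> i * K i j) sums \<delta> j"
proof -
  have partial_le: "(\<Sum>i\<in>A. G k i * K i j) \<le> G k j - of_bool (k = j)" if "finite A" for A k j
    using sum_le_suminf[OF sums_summable[OF green[of k j]] that] sums_unique[OF green[of k j]]
      G_nonneg K_pos by (simp add: less_imp_le)
  have term_le: "G k i * K i j \<le> G k j - of_bool (k = j)" for i j k
    using partial_le[of "{i}"] by simp
  \<comment> \<open>The defect is 1 on the diagonal, so \<open>G k k\<close> is at least 1. One
    further step from \<open>k\<close> to 0 then makes \<open>G k 0\<close> positive, so the rows
    can be normalised by it.\<close>
  have G_diag: "G k k > 0" for k
    using term_le[of k k k] G_nonneg[of k k] K_pos[of k k]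
    by (smt (verit) mult_nonneg_nonneg of_bool_eq(2))
  have G0: "G k 0 > 0" for k
    using term_le[of k k 0] mult_pos_pos[OF G_diag[of k] K_pos[of k 0]]
    by (smt (verit) of_bool_def)
  define g where "g k j = G k j / G k 0" for k j
  have g_nonneg: "g k j \<ge> 0" for k j
    using G_nonneg G0[of k] by (simp add: g_def less_imp_le)
  have g_le: "g k j * K j 0 \<le> 1" for k j
  proof -
    have "G k j * K j 0 \<le> G k 0"
      using term_le[of k j 0] by (smt (verit) of_bool_def)
    then show ?thesis using G0[of k] by (simp add: g_def field_simps)
  qed
  \<comment> \<open>Diagonal extraction needs a bound uniform in \<open>k\<close>. The weight
    \<open>K j 0\<close> provides it and, being positive and independent of \<open>k\<close>, is
    divided out afterwards.\<close>
  obtain r :: "nat \<Rightarrow> nat" where r: "strict_mono r"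
    and conv: "\<And>j. j \<in> UNIV \<Longrightarrow> \<exists>l. (\<lambda>n. g (r n) j * K j 0) \<longlonglongrightarrow> l"
  proof (rule function_convergent_subsequence[of "UNIV :: nat set" "\<lambda>k j. g k j * K j 0" 1])
    show "norm (g k j * K j 0) \<le> 1" for k j
      using g_le g_nonneg[of k j] K_pos[of j 0] by (simp add: abs_mult)
  qed simp_all
  have "\<exists>l. (\<lambda>n. g (r n) j) \<longlonglongrightarrow> l" for j
  proof -
    obtain l where "(\<lambda>n. g (r n) j * K j 0) \<longlonglongrightarrow> l" using conv[OF UNIV_I] by blast
    then have "(\<lambda>n. g (r n) j * K j 0 / K j 0) \<longlonglongrightarrow> l / K j 0"
      using K_pos[of j 0] by (intro tendsto_divide) auto
    then show ?thesis using K_pos[of j 0] by auto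
  qed
  then obtain \<delta> where \<delta>: "\<And>j. (\<lambda>n. g (r n) j) \<longlonglongrightarrow> \<delta> j" by metis
  have \<delta>_nonneg: "\<delta> j \<ge> 0" for j
    by (rule LIMSEQ_le_const[OF \<delta>]) (use g_nonneg in blast)
  have g_term: "g k i * K i j = (G k i * K i j) / G k 0" for k i j
    by (simp add: g_def)
  \<comment> \<open>The Fatou half: finite partial sums commute with the limit, and dropping the
    defect only enlarges the right side.\<close>
  have upper: "(\<Sum>i<n. \<delta> i * K i j) \<le> \<delta> j" for n j
  proof (rule LIMSEQ_le)
    show "(\<lambda>m. \<Sum>i<n. g (r m) i * K i j) \<longlonglongrightarrow> (\<Sum>i<n. \<delta> i * K i j)"
      by (intro tendsto_intros \<delta>)
    show "(\<lambda>m. g (r m) j) \<longlonglongrightarrow> \<delta> j" by (rule \<delta>)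
    have "(\<Sum>i<n. g k i * K i j) \<le> g k j" for k
    proof -
      have "(\<Sum>i<n. G k i * K i j) \<le> G k j"
        using partial_le[of "{..<n}" k j] by (smt (verit) finite_lessThan of_bool_def)
      then show ?thesis
        using G0[of k] unfolding g_term sum_divide_distrib[symmetric]
        by (simp add: g_def divide_right_mono)
    qed
    then show "\<exists>N. \<forall>m\<ge>N. (\<Sum>i<n. g (r m) i * K i j) \<le> g (r m) j" by blast
  qed
  have lower: "\<exists>n0. \<forall>n\<ge>n0. \<delta> j \<le> (\<Sum>i<n. \<delta> i * K i j) + e * \<delta> (Suc j)" if e: "e > 0" for e j
  proof -
    \<comment> \<open>\<open>n0\<close> depends on \<open>e\<close> and \<open>j\<close> but not on
      \<open>k\<close>, so the tail estimate survives the limit in \<open>k\<close>.\<close>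
    obtain n0 where n0: "\<And>i. i \<ge> n0 \<Longrightarrow> K i j / K i (Suc j) < e"
      using order_tendstoD(2)[OF ratio e] by (auto simp: eventually_sequentially)
    have K_le: "K i j \<le> e * K i (Suc j)" if "i \<ge> n0" for i
      using n0[OF that] K_pos[of i "Suc j"] by (simp add: field_simps)
    \<comment> \<open>No mass escapes to infinity: the column \<open>Suc j\<close> controls the tail of column \<open>j\<close>.\<close>
    have G_split: "G k j - of_bool (k = j) \<le> (\<Sum>i<n. G k i * K i j) + e * G k (Suc j)"
      if "n \<ge> n0" for n k
    proof -
      have shift: "(\<lambda>i. G k (i + n) * K (i + n) l)
          sums (G k l - of_bool (k = l) - (\<Sum>i<n. G k i * K i l))" for l
        using sums_split_initial_segment[OF green[of k l], of n] by simp
      have "G k j - of_bool (k = j) - (\<Sum>i<n. G k i * K i j) \<le>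
          e * (G k (Suc j) - of_bool (k = Suc j) - (\<Sum>i<n. G k i * K i (Suc j)))"
      proof (rule sums_le[OF _ shift sums_mult[OF shift]])
        fix i
        show "G k (i + n) * K (i + n) j \<le> e * (G k (i + n) * K (i + n) (Suc j))"
          using mult_left_mono[OF K_le[of "i + n"] G_nonneg[of k "i + n"]] \<open>n \<ge> n0\<close>
          by (simp add: algebra_simps)
      qed
      also have "\<dots> \<le> e * G k (Suc j)"
      proof (intro mult_left_mono)
        have "(\<Sum>i<n. G k i * K i (Suc j)) \<ge> 0"
          using G_nonneg K_pos by (intro sum_nonneg) (simp add: less_imp_le)
        then show "G k (Suc j) - of_bool (k = Suc j) - (\<Sum>i<n. G k i * K i (Suc j)) \<le> G k (Suc j)"
          by (smt (verit) of_bool_def)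
      qed (use e in simp)
      finally show ?thesis by simp
    qed
    have "\<delta> j \<le> (\<Sum>i<n. \<delta> i * K i j) + e * \<delta> (Suc j)" if "n \<ge> n0" for n
    proof (rule LIMSEQ_le)
      show "(\<lambda>m. g (r m) j) \<longlonglongrightarrow> \<delta> j" by (rule \<delta>)
      show "(\<lambda>m. (\<Sum>i<n. g (r m) i * K i j) + e * g (r m) (Suc j))
          \<longlonglongrightarrow> (\<Sum>i<n. \<delta> i * K i j) + e * \<delta> (Suc j)"
        by (intro tendsto_intros \<delta>)
      have "g k j \<le> (\<Sum>i<n. g k i * K i j) + e * g k (Suc j)" if "k \<noteq> j" for k
      proof -
        have "G k j / G k 0 \<le> ((\<Sum>i<n. G k i * K i j) + e * G k (Suc j)) / G k 0"
          using G_split[OF \<open>n \<ge> n0\<close>, of k] that G0[of k] by (intro divide_right_mono) auto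
        then show ?thesis
          by (simp add: g_term add_divide_distrib flip: sum_divide_distrib) (simp add: g_def)
      qed
      \<comment> \<open>Since \<open>r m \<ge> m\<close>, the row index eventually leaves
        \<open>j\<close> behind, and the defect with it.\<close>
      moreover have "r m \<noteq> j" if "m \<ge> Suc j" for m
        using seq_suble[OF r, of m] that by simp
      ultimately show
        "\<exists>N. \<forall>m\<ge>N. g (r m) j \<le> (\<Sum>i<n. g (r m) i * K i j) + e * g (r m) (Suc j)"
        by blast
    qed
    then show ?thesis by blast
  qed
  have invariant: "(\<lambda>i. \<delta> i * K i j) sums \<delta> j" for j
    unfolding sums_def
  proof (rule LIMSEQ_I)
    fix e :: real assume "e > 0"
    \<comment> \<open>The summand 1 guards against \<open>\<delta> (Suc j) = 0\<close>; positivity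
      of \<open>\<delta>\<close> is proved only below.\<close>
    define d where "d = e / (\<delta> (Suc j) + 1)"
    have "d > 0" using \<open>e > 0\<close> \<delta>_nonneg[of "Suc j"] by (simp add: d_def add_nonneg_pos)
    have "d * \<delta> (Suc j) < e"
      using \<open>e > 0\<close> \<delta>_nonneg[of "Suc j"] by (simp add: d_def field_simps)
    then show "\<exists>n0. \<forall>n\<ge>n0. norm ((\<Sum>i<n. \<delta> i * K i j) - \<delta> j) < e"
      using lower[OF \<open>d > 0\<close>, of j] upper[where j = j] by (fastforce simp: abs_less_iff)
  qed
  \<comment> \<open>The normalisation keeps the limit from being zero; the single term
    \<open>\<delta> 0 * K 0 j\<close> of \<open>upper\<close> then spreads positivity to every
    \<open>j\<close>.\<close>
  have "\<delta> 0 = 1"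
    using \<delta>[of 0] G0 by (intro LIMSEQ_unique[OF \<delta>[of 0]]) (simp add: g_def less_imp_neq[symmetric])
  then have "\<delta> j > 0" for j
    using upper[of j "Suc 0"] K_pos[of 0 j] by simp
  then show thesis using invariant that by blast
qed

section \<open>Green functions and hitting probabilities of kernels\<close>

text \<open>Values in \<open>ennreal\<close> let all sums be formed and interchanged before
  finiteness is known. The recursion peels off the first step, as first-step analysis
  requires.\<close>

primrec kernel_power :: "('s \<Rightarrow> 's \<Rightarrow> ennreal) \<Rightarrow> nat \<Rightarrow> 's \<Rightarrow> 's \<Rightarrow> ennreal" where
  "kernel_power K 0 i j = of_bool (i = j)"
| "kernel_power K (Suc n) i j = (\<integral>\<^sup>+l. K i l * kernel_power K n l j \<partial>count_space UNIV)"

definition green_function :: "('s \<Rightarrow> 's \<Rightarrow> ennreal) \<Rightarrow> 's \<Rightarrow> 's \<Rightarrow> ennreal" where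
  "green_function K i j = (\<Sum>n. kernel_power K n i j)"

text \<open>The probability of visiting \<open>a\<close> at one of the times \<open>1, \<dots>, n\<close>.\<close>

primrec hitting_prob :: "('s \<Rightarrow> 's \<Rightarrow> ennreal) \<Rightarrow> 's \<Rightarrow> nat \<Rightarrow> 's \<Rightarrow> ennreal" where
  "hitting_prob K a 0 i = 0"
| "hitting_prob K a (Suc n) i =
     (\<integral>\<^sup>+l. K i l * (if l = a then 1 else hitting_prob K a n l) \<partial>count_space UNIV)"

lemma nn_integral_count_space_swap:
  fixes f :: "nat \<Rightarrow> nat \<Rightarrow> ennreal"
  shows "(\<integral>\<^sup>+x. (\<integral>\<^sup>+y. f x y \<partial>count_space UNIV) \<partial>count_space UNIV) =
    (\<integral>\<^sup>+y. (\<integral>\<^sup>+x. f x y \<partial>count_space UNIV) \<partial>count_space UNIV)"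
  by (subst (1 4) nn_integral_count_space_nat) (rule nn_integral_suminf[symmetric], simp)

lemma nn_integral_count_space_of_bool:
  fixes f :: "'s \<Rightarrow> ennreal"
  shows "(\<integral>\<^sup>+l. f l * of_bool (l = a) \<partial>count_space UNIV) = f a"
    "(\<integral>\<^sup>+l. of_bool (a = l) * f l \<partial>count_space UNIV) = f a"
proof -
  have *: "(\<integral>\<^sup>+l. f l * indicator {a} l \<partial>count_space UNIV) = f a"
    by (subst nn_integral_count_space_indicator[symmetric])
      (simp_all add: nn_integral_count_space_finite)
  show "(\<integral>\<^sup>+l. f l * of_bool (l = a) \<partial>count_space UNIV) = f a"
    "(\<integral>\<^sup>+l. of_bool (a = l) * f l \<partial>count_space UNIV) = f a"
    unfolding *[symmetric] by (auto intro!: nn_integral_cong simp: indicator_def)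
qed

text \<open>The Green equation needs the last step peeled off instead of the first; Tonelli
  exchanges the two intermediate states.\<close>

lemma kernel_power_Suc_right:
  fixes K :: "nat \<Rightarrow> nat \<Rightarrow> ennreal"
  shows "kernel_power K (Suc n) i j = (\<integral>\<^sup>+l. kernel_power K n i l * K l j \<partial>count_space UNIV)"
proof (induction n arbitrary: i)
  case 0
  then show ?case by (simp add: nn_integral_count_space_of_bool)
next
  case (Suc n)
  have "kernel_power K (Suc (Suc n)) i j =
      (\<integral>\<^sup>+l. (\<integral>\<^sup>+m. K i l * (kernel_power K n l m * K m j) \<partial>count_space UNIV) \<partial>count_space UNIV)"
    by (subst kernel_power.simps) (simp add: Suc.IH nn_integral_cmult del: kernel_power.simps)
  also have "\<dots> =
      (\<integral>\<^sup>+m. (\<integral>\<^sup>+l. K i l * (kernel_power K n l m * K m j) \<partial>count_space UNIV) \<partial>count_space UNIV)"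
    by (rule nn_integral_count_space_swap)
  also have "\<dots> = (\<integral>\<^sup>+m. kernel_power K (Suc n) i m * K m j \<partial>count_space UNIV)"
    by (simp add: nn_integral_multc[symmetric] mult.assoc)
  finally show ?case .
qed

text \<open>This is \<open>G = I + G P\<close>, invariance of each row up to a unit defect: time 0
  gives the identity, and the last-step recursion summed over time gives the rest.\<close>

lemma green_function_right:
  fixes K :: "nat \<Rightarrow> nat \<Rightarrow> ennreal"
  shows "green_function K i j =
    of_bool (i = j) + (\<integral>\<^sup>+l. green_function K i l * K l j \<partial>count_space UNIV)"
proof -
  have "green_function K i j = of_bool (i = j) + (\<Sum>n. kernel_power K (Suc n) i j)"
    unfolding green_function_def
    by (subst suminf_offset[of _ 1]) (simp_all del: kernel_power.simps(2))
  also have "(\<Sum>n. kernel_power K (Suc n) i j) =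
      (\<integral>\<^sup>+l. green_function K i l * K l j \<partial>count_space UNIV)"
    unfolding kernel_power_Suc_right green_function_def ennreal_suminf_multc[symmetric]
    by (rule nn_integral_suminf[symmetric]) simp
  finally show ?thesis .
qed

text \<open>Starting with a step to \<open>l\<close> is one of the ways to get from \<open>i\<close>
  to \<open>j\<close>. This carries finiteness from the diagonal to the other entries.\<close>

lemma green_function_left_le:
  fixes K :: "nat \<Rightarrow> nat \<Rightarrow> ennreal"
  shows "K i l * green_function K l j \<le> green_function K i j"
proof -
  have "K i l * green_function K l j = (\<Sum>n. K i l * kernel_power K n l j)"
    by (simp add: green_function_def)
  also have "\<dots> \<le> (\<Sum>n. kernel_power K (Suc n) i j)"
  proof (intro suminf_le summableI)
    fix n
    show "K i l * kernel_power K n l j \<le> kernel_power K (Suc n) i j"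
      using nn_integral_ge_point[of l UNIV "\<lambda>l. K i l * kernel_power K n l j"] by simp
  qed
  also have "\<dots> \<le> green_function K i j"
    unfolding green_function_def
    by (subst (2) suminf_offset[of _ 1]) (simp_all del: kernel_power.simps(2))
  finally show ?thesis .
qed

text \<open>First-passage decomposition of the expected number of visits to \<open>a\<close> up to time \<open>n\<close>.\<close>

lemma expected_visits_le:
  fixes K :: "nat \<Rightarrow> nat \<Rightarrow> ennreal"
  shows "(\<Sum>m\<le>n. kernel_power K m i a) \<le>
    of_bool (i = a) + hitting_prob K a n i * (\<Sum>m\<le>n - 1. kernel_power K m a a)"
\<comment> \<open>A visit at time 1 or later leaves at most \<open>n - 1\<close> further steps.
  Truncated subtraction is harmless at \<open>n = 0\<close>, where the hitting probability is
  0.\<close>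
proof (induction n arbitrary: i)
  case 0
  then show ?case by simp
next
  case (Suc n)
  define U where "U = (\<Sum>m\<le>n. kernel_power K m a a)"
  have "(\<Sum>m\<le>n. kernel_power K m l a) \<le> (if l = a then 1 else hitting_prob K a n l) * U" for l
  proof (cases "l = a")
    case False
    have "(\<Sum>m\<le>n - 1. kernel_power K m a a) \<le> U"
      unfolding U_def by (intro sum_mono2) auto
    then have "hitting_prob K a n l * (\<Sum>m\<le>n - 1. kernel_power K m a a) \<le> hitting_prob K a n l * U"
      by (rule mult_left_mono) simp
    then show ?thesis
      using Suc.IH[of l] False by auto
  qed (simp add: U_def)
  then have step: "K i l * (\<Sum>m\<le>n. kernel_power K m l a) \<le>
      K i l * (if l = a then 1 else hitting_prob K a n l) * U" for l
    by (simp add: mult_left_mono mult.assoc)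
  have "(\<Sum>m\<le>Suc n. kernel_power K m i a) =
      of_bool (i = a) + (\<Sum>m\<le>n. kernel_power K (Suc m) i a)"
    by (subst sum.atMost_Suc_shift) simp
  also have "(\<Sum>m\<le>n. kernel_power K (Suc m) i a) =
      (\<integral>\<^sup>+l. K i l * (\<Sum>m\<le>n. kernel_power K m l a) \<partial>count_space UNIV)"
    by (simp add: nn_integral_sum sum_distrib_left)
  also have "\<dots> \<le> (\<integral>\<^sup>+l. K i l * (if l = a then 1 else hitting_prob K a n l) * U \<partial>count_space UNIV)"
    by (intro nn_integral_mono step)
  also have "\<dots> = hitting_prob K a (Suc n) i * U"
    by (simp add: nn_integral_multc)
  finally show ?case by (simp add: U_def add_left_mono)
qed

text \<open>The expected visits \<open>u n\<close> up to time \<open>n\<close> satisfy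
  \<open>u (n + 1) \<le> 1 + h * u n\<close>, and \<open>1 / (1 - h)\<close> is the fixed point of
  this recursion. Working with finite horizons is essential: the limiting inequality
  \<open>u \<le> 1 + h * u\<close> also admits infinity when \<open>h > 0\<close>.\<close>

lemma green_function_diag_finite:
  fixes K :: "nat \<Rightarrow> nat \<Rightarrow> ennreal" and h :: real
  assumes hit: "\<And>n. hitting_prob K a n a \<le> ennreal h" and h: "0 \<le> h" "h < 1"
  shows "green_function K a a < \<infinity>"
proof -
  have bound: "(\<Sum>m\<le>n. kernel_power K m a a) \<le> ennreal (1 / (1 - h))" for n
  proof (induction n)
    case 0
    have "ennreal 1 \<le> ennreal (1 / (1 - h))"
      using h by (intro ennreal_leI) (simp add: field_simps)
    then show ?case by simp
  next
    case (Suc n)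
    have "(\<Sum>m\<le>Suc n. kernel_power K m a a) \<le>
        1 + hitting_prob K a (Suc n) a * (\<Sum>m\<le>n. kernel_power K m a a)"
      using expected_visits_le[of K a a "Suc n"] by simp
    also have "\<dots> \<le> 1 + ennreal h * ennreal (1 / (1 - h))"
      by (intro add_left_mono mult_mono hit Suc.IH) auto
    also have "\<dots> = ennreal (1 + h * (1 / (1 - h)))"
      using h by (simp add: ennreal_plus ennreal_mult[symmetric] del: ennreal_plus flip: ennreal_plus ennreal_1)
    also have "1 + h * (1 / (1 - h)) = 1 / (1 - h)"
      using h by (simp add: field_simps)
    finally show ?case .
  qed
  have "green_function K a a \<le> ennreal (1 / (1 - h))"
    unfolding green_function_def suminf_eq_SUP
  proof (rule SUP_least)
    fix n
    have "(\<Sum>m<n. kernel_power K m a a) \<le> (\<Sum>m\<le>n. kernel_power K m a a)"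
      by (intro sum_mono2) auto
    then show "(\<Sum>m<n. kernel_power K m a a) \<le> ennreal (1 / (1 - h))"
      using bound[of n] by (rule order_trans)
  qed
  then show ?thesis by (rule order_le_less_trans) simp
qed

text \<open>An infinite \<open>green_function K i j\<close> would make
  \<open>green_function K j j\<close> infinite, since the step from \<open>j\<close> to
  \<open>i\<close> has positive weight.\<close>

lemma positive_kernel_green_function_finite:
  fixes K :: "nat \<Rightarrow> nat \<Rightarrow> ennreal"
  assumes "\<And>i j. K i j > 0" and "\<And>j. green_function K j j < \<infinity>"
  shows "green_function K i j < \<infinity>"
  using green_function_left_le[of K j i j] assms
  by (metis ennreal_mult_eq_top_iff infinity_ennreal_def less_irrefl linorder_not_less order.strict_trans1
      top.not_eq_extremum)


section \<open>Measurability and path properties of the Lamperti process\<close>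

lemma measurable_Max_image:
  fixes Y :: "nat \<Rightarrow> 'a \<Rightarrow> nat"
  assumes Y: "\<And>j. j \<ge> 1 \<Longrightarrow> Y j \<in> L \<rightarrow>\<^sub>M count_space UNIV"
  shows "(\<lambda>\<omega>. Max ((\<lambda>j. Y j \<omega>) ` {1..x})) \<in> L \<rightarrow>\<^sub>M count_space UNIV"
proof (induction x)
  case (Suc x)
  show ?case
  proof (cases "x = 0")
    case False
    then have "Max ((\<lambda>j. Y j \<omega>) ` {1..Suc x}) =
        max (Y (Suc x) \<omega>) (Max ((\<lambda>j. Y j \<omega>) ` {1..x}))" for \<omega>
      by (subst atLeastAtMostSuc_conv) auto
    moreover have "(\<lambda>\<omega>. max (Y (Suc x) \<omega>) (Max ((\<lambda>j. Y j \<omega>) ` {1..x}))) \<in> L \<rightarrow>\<^sub>M count_space UNIV"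
      using Suc.IH Y[of "Suc x"] by measurable
    ultimately show ?thesis by simp
  qed (use Y[of "Suc 0"] in simp)
qed simp

lemma measurable_lamperti:
  assumes N: "\<And>j n. j \<ge> 1 \<Longrightarrow> n \<ge> 1 \<Longrightarrow> N j n \<in> L \<rightarrow>\<^sub>M count_space UNIV"
  shows "lamperti N x n \<in> L \<rightarrow>\<^sub>M count_space UNIV"
proof (induction n)
  case (Suc n)
  \<comment> \<open>The index range is random but takes countably many values, so fixed ranges
    suffice.\<close>
  have "(\<lambda>\<omega>. Max ((\<lambda>j. N j (Suc n) \<omega>) ` {1..lamperti N x n \<omega>})) \<in> L \<rightarrow>\<^sub>M count_space UNIV"
    using N by (intro measurable_compose_countable[OF measurable_Max_image Suc.IH]) auto
  then show ?case by simp
qed simp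

text \<open>Restarting at generation 1 turns a hit at a later time into a hit by the process driven
  by the shifted numbers, matching the recursion of \<open>hitting_prob\<close>.\<close>

lemma lamperti_shift:
  "lamperti N x (Suc n) \<omega> = lamperti (\<lambda>j n. N j (Suc n)) (lamperti N x 1 \<omega>) n \<omega>"
  by (induction n) simp_all

text \<open>The process reads only indices from 1 on, so it can be evaluated on families restricted
  to a block of indices.\<close>

lemma lamperti_cong:
  assumes "\<And>j n. j \<ge> 1 \<Longrightarrow> n \<ge> 1 \<Longrightarrow> N j n \<omega> = N' j n \<omega>'"
  shows "lamperti N x n \<omega> = lamperti N' x n \<omega>'"
proof (induction n)
  case (Suc n)
  have "(\<lambda>j. N j (Suc n) \<omega>) ` {1..lamperti N x n \<omega>} =
      (\<lambda>j. N' j (Suc n) \<omega>') ` {1..lamperti N x n \<omega>}"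
    using assms by (intro image_cong) auto
  then show ?case using Suc.IH by simp
qed simp

section \<open>One-step law and Markov property\<close>

text \<open>These two conditions are stable under discarding the first generation, which allows
  induction over the time horizon.\<close>

locale branching_numbers = prob_space M for M :: "'a measure" +
  fixes N :: "nat \<Rightarrow> nat \<Rightarrow> 'a \<Rightarrow> nat" and F :: "nat \<Rightarrow> real"
  assumes indep: "indep_vars (\<lambda>_. count_space UNIV) (\<lambda>(j, n). N j n) ({1..} \<times> {1..})"
    and cdf: "\<And>j n m. j \<ge> 1 \<Longrightarrow> n \<ge> 1 \<Longrightarrow> prob {\<omega> \<in> space M. N j n \<omega> \<le> m} = F m"
begin

lemma measurable_N: "j \<ge> 1 \<Longrightarrow> n \<ge> 1 \<Longrightarrow> N j n \<in> M \<rightarrow>\<^sub>M count_space UNIV"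
  using indep unfolding indep_vars_def2 by force

lemma shift: "branching_numbers M (\<lambda>j n. N j (Suc n)) F"
proof unfold_locales
  let ?X = "\<lambda>(j, n). N j n" and ?f = "\<lambda>(j :: nat, n). (j, Suc n)"
  \<comment> \<open>Independence is reindexed along the injection \<open>?f\<close> by restricting
    to disjoint singleton blocks and then evaluating each at its only index.\<close>
  have "indep_vars (\<lambda>p. PiM {?f p} (\<lambda>_. count_space UNIV))
      (\<lambda>p \<omega>. restrict (\<lambda>q. ?X q \<omega>) {?f p}) ({1..} \<times> {1..})"
    by (rule indep_vars_restrict[OF indep]) (auto simp: disjoint_family_on_def)
  then have "indep_vars (\<lambda>p. count_space UNIV)
      (\<lambda>p \<omega>. restrict (\<lambda>q. ?X q \<omega>) {?f p} (?f p)) ({1..} \<times> {1..})"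
    by (rule indep_vars_compose2[where Y = "\<lambda>p v. v (?f p)"])
      (rule measurable_component_singleton, simp)
  then show "indep_vars (\<lambda>_. count_space UNIV) (\<lambda>(j, n). N j (Suc n)) ({1..} \<times> {1..})"
    by (simp add: case_prod_unfold)
qed (use cdf in auto)

text \<open>A maximum is at most \<open>m\<close> iff every one of the \<open>x\<close> independent
  numbers is; \<open>x \<ge> 1\<close> excludes \<open>Max {}\<close>.\<close>

lemma prob_lamperti_1_le:
  assumes "x \<ge> 1"
  shows "prob {\<omega> \<in> space M. lamperti N x 1 \<omega> \<le> m} = F m ^ x"
proof -
  let ?X = "\<lambda>(j, n). N j n"
  have "{\<omega> \<in> space M. lamperti N x 1 \<omega> \<le> m} = (\<Inter>p\<in>{1..x} \<times> {1}. ?X p -` {..m} \<inter> space M)"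
    using assms by (auto simp: Max_le_iff)
  also have "prob \<dots> = (\<Prod>p\<in>{1..x} \<times> {1}. prob (?X p -` {..m} \<inter> space M))"
    using assms by (intro indep_varsD[OF indep]) auto
  also have "\<dots> = (\<Prod>p\<in>{1..x} \<times> {1 :: nat}. F m)"
  proof (rule prod.cong[OF refl])
    fix p :: "nat \<times> nat" assume "p \<in> {1..x} \<times> {1}"
    then show "prob (?X p -` {..m} \<inter> space M) = F m"
      by (auto simp flip: cdf[of "fst p" 1 m] intro!: arg_cong[where f = prob])
  qed
  also have "\<dots> = F m ^ x" by simp
  finally show ?thesis .
qed

lemma prob_lamperti_1:
  assumes "x \<ge> 1" "y \<ge> 1"
  shows "prob {\<omega> \<in> space M. lamperti N x 1 \<omega> = y} = lamperti_matrix F x y"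
proof -
  note [measurable] = measurable_lamperti[OF measurable_N]
  have "{\<omega> \<in> space M. lamperti N x 1 \<omega> = y} =
      {\<omega> \<in> space M. lamperti N x 1 \<omega> \<le> y} - {\<omega> \<in> space M. lamperti N x 1 \<omega> \<le> y - 1}"
    using assms(2) by auto
  also have "prob \<dots> = F y ^ x - F (y - 1) ^ x"
    by (subst finite_measure_Diff) (auto simp: prob_lamperti_1_le assms simp del: lamperti.simps One_nat_def)
  finally show ?thesis by (simp add: lamperti_matrix_def)
qed

definition hits :: "nat \<Rightarrow> nat \<Rightarrow> nat \<Rightarrow> 'a set" where
  "hits a n x = {\<omega> \<in> space M. \<exists>k\<in>{1..n}. lamperti N x k \<omega> = a}"

lemma sets_hits [measurable]: "hits a n x \<in> events"
proof -
  note [measurable] = measurable_lamperti[OF measurable_N]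
  show ?thesis unfolding hits_def by measurable
qed

text \<open>The first event depends on generation 1 only. The second starts from a fixed state
  \<open>z\<close> and depends on generations from 2 on, so the two are independent.\<close>

lemma markov_property:
  defines "hits' \<equiv> branching_numbers.hits M (\<lambda>j n. N j (Suc n))"
  shows "prob ({\<omega> \<in> space M. lamperti N x 1 \<omega> = y} \<inter> hits' a n z) =
    prob {\<omega> \<in> space M. lamperti N x 1 \<omega> = y} * prob (hits' a n z)"
proof -
  let ?X = "\<lambda>(j, n). N j n" and ?A = "{1..} \<times> {1 :: nat}" and ?B = "{1..} \<times> {2 :: nat..}"
  let ?P = "\<lambda>A :: (nat \<times> nat) set. PiM A (\<lambda>_. count_space (UNIV :: nat set))"
  let ?R = "\<lambda>A \<omega>. restrict (\<lambda>p. ?X p \<omega>) A"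
  \<comment> \<open>Both events are pulled back from product spaces over the disjoint blocks
    \<open>?A\<close> and \<open>?B\<close>, where independence of the restricted families
    applies.\<close>
  define now where "now = {v \<in> space (?P ?A). lamperti (\<lambda>j n v. v (j, 1)) x 1 v = y}"
  define later where "later = {v \<in> space (?P ?B). \<exists>k\<in>{1..n}. lamperti (\<lambda>j n v. v (j, Suc n)) z k v = a}"
  have now: "now \<in> sets (?P ?A)"
  proof -
    have [measurable]: "lamperti (\<lambda>j n v. v (j, 1)) x 1 \<in> ?P ?A \<rightarrow>\<^sub>M count_space UNIV"
      by (rule measurable_lamperti) (rule measurable_component_singleton, auto)
    show ?thesis unfolding now_def by measurable
  qed
  have later: "later \<in> sets (?P ?B)"
  proof -
    have [measurable]: "lamperti (\<lambda>j n v. v (j, Suc n)) z k \<in> ?P ?B \<rightarrow>\<^sub>M count_space UNIV" for k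
      by (rule measurable_lamperti) (rule measurable_component_singleton, auto)
    show ?thesis unfolding later_def by measurable
  qed
  have R_space: "?R A \<omega> \<in> space (?P A)" for A \<omega>
    by (simp add: space_PiM)
  have R_now: "lamperti (\<lambda>j n v. v (j, 1)) x 1 (?R ?A \<omega>) = lamperti N x 1 \<omega>" for \<omega>
    by (auto intro!: arg_cong[where f = Max] image_cong)
  have R_later: "lamperti (\<lambda>j n v. v (j, Suc n)) z k (?R ?B \<omega>) = lamperti (\<lambda>j n. N j (Suc n)) z k \<omega>" for k \<omega>
    by (rule lamperti_cong) auto
  have now_eq: "?R ?A -` now \<inter> space M = {\<omega> \<in> space M. lamperti N x 1 \<omega> = y}"
    by (rule set_eqI) (simp only: now_def vimage_eq mem_Collect_eq Int_iff R_now R_space simp_thms conj_commute)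
  have later_eq: "?R ?B -` later \<inter> space M = hits' a n z"
    by (rule set_eqI) (simp only: later_def hits'_def branching_numbers.hits_def[OF shift]
        vimage_eq mem_Collect_eq Int_iff R_later R_space simp_thms conj_commute)
  have R_indep: "indep_var (?P ?A) (?R ?A) (?P ?B) (?R ?B)"
    by (rule indep_var_restrict[OF indep]) auto
  have joint: "(\<lambda>\<omega>. (?R ?A \<omega>, ?R ?B \<omega>)) -` (now \<times> later) \<inter> space M =
      (?R ?A -` now \<inter> space M) \<inter> (?R ?B -` later \<inter> space M)"
    by (rule set_eqI) (simp only: vimage_eq mem_Times_iff fst_conv snd_conv Int_iff, blast)
  show ?thesis
    using indep_varD[OF R_indep now later] unfolding joint now_eq later_eq .
qed

end

section \<open>From the transient process to its kernel\<close>

text \<open>First-step analysis: the state after one step splits the hitting event, and the Markov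
  property factors each piece. \<open>N\<close> varies in the induction because the remaining steps
  use the shifted numbers. The upper bound is what transfers transience to the kernel.\<close>

lemma hitting_prob_le_lamperti:
  assumes "branching_numbers M N F"
  shows "hitting_prob (\<lambda>i j. ennreal (lamperti_matrix F (Suc i) (Suc j))) a n i
    \<le> emeasure M (branching_numbers.hits M N (Suc a) n (Suc i))"
  using assms
proof (induction n arbitrary: N i)
  case 0
  then show ?case by simp
next
  case (Suc n)
  interpret branching_numbers M N F by fact
  interpret later: branching_numbers M "\<lambda>j n. N j (Suc n)" F by (rule shift)
  note [measurable] = measurable_lamperti[OF measurable_N]
  define step where "step l = {\<omega> \<in> space M. lamperti N (Suc i) 1 \<omega> = Suc l}" for l
  \<comment> \<open>If the first step lands on the target, nothing more is required; otherwise it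
    must be hit in the remaining \<open>n\<close> steps.\<close>
  define D where "D l = step l \<inter> (if l = a then space M else later.hits (Suc a) n (Suc l))" for l
  have [measurable]: "step l \<in> events" for l
    unfolding step_def by measurable
  have D_sets: "D l \<in> events" for l
    by (simp add: D_def sets.Int)
  have prob_step: "prob (step l) = lamperti_matrix F (Suc i) (Suc l)" for l
    unfolding step_def by (rule prob_lamperti_1) auto
  have le_D: "ennreal (lamperti_matrix F (Suc i) (Suc l)) *
      (if l = a then 1 else hitting_prob (\<lambda>i j. ennreal (lamperti_matrix F (Suc i) (Suc j))) a n l)
      \<le> emeasure M (D l)" for l
  proof (cases "l = a")
    case True
    have "step l \<inter> space M = step l" by (auto simp: step_def)
    then show ?thesis
      using True by (simp add: D_def emeasure_eq_measure prob_step)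
  next
    case False
    have "emeasure M (D l) = ennreal (prob (step l)) * emeasure M (later.hits (Suc a) n (Suc l))"
      using False markov_property
      by (simp add: D_def step_def emeasure_eq_measure ennreal_mult del: lamperti.simps One_nat_def)
    then show ?thesis
      using False Suc.IH[OF shift, of l] by (simp add: prob_step mult_left_mono)
  qed
  have "disjoint_family D"
    by (auto simp: disjoint_family_on_def D_def step_def)
  have "hitting_prob (\<lambda>i j. ennreal (lamperti_matrix F (Suc i) (Suc j))) a (Suc n) i
      \<le> (\<integral>\<^sup>+l. emeasure M (D l) \<partial>count_space UNIV)"
    unfolding hitting_prob.simps by (intro nn_integral_mono le_D)
  also have "\<dots> = emeasure M (\<Union>l. D l)"
    unfolding nn_integral_count_space_nat
    using D_sets \<open>disjoint_family D\<close> by (intro suminf_emeasure) auto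
  also have "\<dots> \<le> emeasure M (hits (Suc a) (Suc n) (Suc i))"
  proof (rule emeasure_mono)
    show "(\<Union>l. D l) \<subseteq> hits (Suc a) (Suc n) (Suc i)"
    proof
      fix \<omega> assume "\<omega> \<in> (\<Union>l. D l)"
      then obtain l where l: "\<omega> \<in> step l" "\<omega> \<in> (if l = a then space M else later.hits (Suc a) n (Suc l))"
        by (auto simp: D_def)
      from l(1) have \<omega>: "\<omega> \<in> space M" "lamperti N (Suc i) 1 \<omega> = Suc l"
        by (auto simp: step_def)
      have "\<exists>k\<in>{1..Suc n}. lamperti N (Suc i) k \<omega> = Suc a"
      proof (cases "l = a")
        case True
        then show ?thesis using \<omega>(2) by (intro bexI[of _ 1]) auto
      next
        case False
        then obtain k where "k \<in> {1..n}" "lamperti (\<lambda>j n. N j (Suc n)) (Suc l) k \<omega> = Suc a"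
          using l(2) by (auto simp: later.hits_def)
        then show ?thesis
          using lamperti_shift[of N "Suc i" k \<omega>] \<omega>(2) by (intro bexI[of _ "Suc k"]) auto
      qed
      then show "\<omega> \<in> hits (Suc a) (Suc n) (Suc i)" using \<omega>(1) by (simp add: hits_def)
    qed
  qed simp
  finally show ?case .
qed

text \<open>Dividing both entries by the dominant power of \<open>F (Suc j)\<close> leaves powers of
  \<open>?c\<close> and \<open>?d\<close>, both in [0, 1), with a factor \<open>?d ^ Suc i\<close>
  in the numerator.\<close>

lemma lamperti_matrix_ratio_tendsto_0:
  assumes "0 \<le> F (j - 1)" "F (j - 1) < F j" "F j < F (Suc j)"
  shows "(\<lambda>i. lamperti_matrix F (Suc i) j / lamperti_matrix F (Suc i) (Suc j)) \<longlonglongrightarrow> 0"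
proof -
  let ?c = "F (j - 1) / F j" and ?d = "F j / F (Suc j)"
  have "0 < F j" "0 < F (Suc j)" using assms by auto
  have "(\<lambda>i. ?d ^ Suc i * (1 - ?c ^ Suc i) / (1 - ?d ^ Suc i)) \<longlonglongrightarrow> 0 * (1 - 0) / (1 - 0)"
    using assms \<open>0 < F j\<close> by (intro tendsto_intros LIMSEQ_Suc LIMSEQ_power_zero) auto
  moreover have "?d ^ Suc i * (1 - ?c ^ Suc i) / (1 - ?d ^ Suc i) =
      lamperti_matrix F (Suc i) j / lamperti_matrix F (Suc i) (Suc j)" for i
  proof -
    have "?d ^ Suc i * (1 - ?c ^ Suc i) = lamperti_matrix F (Suc i) j / F (Suc j) ^ Suc i"
      "1 - ?d ^ Suc i = lamperti_matrix F (Suc i) (Suc j) / F (Suc j) ^ Suc i"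
      using \<open>0 < F j\<close> \<open>0 < F (Suc j)\<close>
      by (simp_all add: lamperti_matrix_def power_divide field_simps del: power_Suc)
    then show ?thesis using \<open>0 < F (Suc j)\<close> by simp
  qed
  ultimately show ?thesis by simp
qed

section \<open>Existence of the invariant measure\<close>

theorem proposition7:
  fixes \<Omega> :: "'b measure" and \<nu> :: "'b \<Rightarrow> nat" and F :: "nat \<Rightarrow> real"
    and M :: "'a measure" and N :: "nat \<Rightarrow> nat \<Rightarrow> 'a \<Rightarrow> nat"
  assumes "prob_space \<Omega>" and "\<nu> \<in> measurable \<Omega> (count_space UNIV)"
    and "\<And>j. j \<ge> 1 \<Longrightarrow> measure \<Omega> {\<omega> \<in> space \<Omega>. \<nu> \<omega> = j} > 0"
    and "((\<lambda>j. measure \<Omega> {\<omega> \<in> space \<Omega>. \<nu> \<omega> = j}) has_sum 1) {1..}"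
    and "\<And>j. F j = measure \<Omega> {\<omega> \<in> space \<Omega>. \<nu> \<omega> \<le> j}"
    and "prob_space M" and "iid_copies \<Omega> \<nu> M N"
    and "transient_chain M {1..} (lamperti N)"
  shows "\<exists>\<delta> :: nat \<Rightarrow> real. (\<forall>j\<ge>1. 0 < \<delta> j) \<and>
           (\<forall>j\<ge>1. ((\<lambda>i. \<delta> i * lamperti_matrix F i j) has_sum \<delta> j) {1..})"
proof -
  interpret \<Omega>: prob_space \<Omega> by fact
  interpret M: prob_space M by fact
  note [measurable] = \<open>\<nu> \<in> measurable \<Omega> (count_space UNIV)\<close>
  have F_nonneg: "F j \<ge> 0" for j
    by (simp add: assms(5))
  have F_Suc: "F j < F (Suc j)" for j
  proof -
    have "{\<omega> \<in> space \<Omega>. \<nu> \<omega> \<le> Suc j} =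
        {\<omega> \<in> space \<Omega>. \<nu> \<omega> \<le> j} \<union> {\<omega> \<in> space \<Omega>. \<nu> \<omega> = Suc j}" by auto
    then have "F (Suc j) = F j + measure \<Omega> {\<omega> \<in> space \<Omega>. \<nu> \<omega> = Suc j}"
      unfolding assms(5) by (simp add: \<Omega>.finite_measure_Union disjoint_iff)
    then show ?thesis using assms(3)[of "Suc j"] by simp
  qed
  have indep: "M.indep_vars (\<lambda>_. count_space UNIV) (\<lambda>(j, n). N j n) ({1..} \<times> {1..})"
    and distr: "\<And>j n. j \<ge> 1 \<Longrightarrow> n \<ge> 1 \<Longrightarrow>
      distr M (count_space UNIV) (N j n) = distr \<Omega> (count_space UNIV) \<nu>"
    using assms(7) by (auto simp: iid_copies_def)
  interpret branching_numbers M N F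
  proof unfold_locales
    show "M.prob {\<omega> \<in> space M. N j n \<omega> \<le> m} = F m" if "j \<ge> 1" "n \<ge> 1" for j n m
    proof -
      have N: "N j n \<in> M \<rightarrow>\<^sub>M count_space UNIV"
        using indep that unfolding M.indep_vars_def2 by force
      have "measure (distr M (count_space UNIV) (N j n)) {..m} =
          measure (distr \<Omega> (count_space UNIV) \<nu>) {..m}"
        by (simp only: distr[OF that])
      then show ?thesis
        using N by (simp add: measure_distr assms(5) vimage_def Int_def conj_commute)
    qed
  qed (rule indep)
  define K where "K i j = lamperti_matrix F (Suc i) (Suc j)" for i j
  define G where "G = green_function (\<lambda>i j. ennreal (K i j))"
  have K_pos: "K i j > 0" for i j
    using power_strict_mono[OF F_Suc[of j] F_nonneg, of "Suc i"]
    by (simp add: K_def lamperti_matrix_def)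
  have G_finite: "G i j < \<infinity>" for i j
    unfolding G_def
  proof (rule positive_kernel_green_function_finite)
    fix a
    note [measurable] = measurable_lamperti[OF measurable_N]
    \<comment> \<open>The return event contains every finite-horizon hitting event, so its
      probability, below 1 by transience, serves as the uniform bound \<open>h\<close>.\<close>
    let ?R = "{\<omega> \<in> space M. \<exists>n\<ge>1. lamperti N (Suc a) n \<omega> = Suc a}"
    show "green_function (\<lambda>i j. ennreal (K i j)) a a < \<infinity>"
    proof (rule green_function_diag_finite)
      fix n
      have "hitting_prob (\<lambda>i j. ennreal (K i j)) a n a \<le> emeasure M (hits (Suc a) n (Suc a))"
        unfolding K_def by (rule hitting_prob_le_lamperti) unfold_locales
      also have "\<dots> \<le> emeasure M ?R"
        by (rule emeasure_mono) (auto simp: hits_def)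
      finally show "hitting_prob (\<lambda>i j. ennreal (K i j)) a n a \<le> ennreal (M.prob ?R)"
        by (simp add: M.emeasure_eq_measure)
      show "M.prob ?R < 1"
        using assms(8) by (simp add: transient_chain_def)
    qed simp
  qed (use K_pos in simp)
  define g where "g i j = enn2real (G i j)" for i j
  have G_eq: "G i j = ennreal (g i j)" for i j
    using G_finite[of i j] by (simp add: g_def less_top)
  have g_nonneg: "g i j \<ge> 0" for i j by (simp add: g_def)
  \<comment> \<open>Finiteness of the left side of the \<open>ennreal\<close> identity yields
    summability; only then can the defect be subtracted in the reals.\<close>
  have green: "(\<lambda>i. g k i * K i j) sums (g k j - of_bool (k = j))" for k j
  proof -
    have nonneg: "0 \<le> g k i * K i j" for i
      using g_nonneg K_pos by (simp add: less_imp_le)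
    have eq: "ennreal (g k j) = of_bool (k = j) + (\<Sum>i. ennreal (g k i * K i j))"
      using green_function_right[of "\<lambda>i j. ennreal (K i j)" k j]
      by (simp add: nn_integral_count_space_nat G_eq g_nonneg K_pos less_imp_le ennreal_mult flip: G_def)
    then have "(\<Sum>i. ennreal (g k i * K i j)) \<noteq> top"
      by (metis ennreal_add_eq_top ennreal_neq_top)
    with nonneg have summable: "summable (\<lambda>i. g k i * K i j)"
      by (rule summable_suminf_not_top)
    have "ennreal (g k j) = ennreal (of_bool (k = j) + (\<Sum>i. g k i * K i j))"
      using eq nonneg summable by (simp add: suminf_ennreal2 suminf_nonneg of_bool_def)
    then have "g k j = of_bool (k = j) + (\<Sum>i. g k i * K i j)"
      by (subst (asm) ennreal_inj) (use nonneg summable g_nonneg in \<open>simp_all add: suminf_nonneg\<close>)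
    then show ?thesis using summable by (simp add: sums_iff)
  qed
  have ratio: "(\<lambda>i. K i j / K i (Suc j)) \<longlonglongrightarrow> 0" for j
    unfolding K_def using F_Suc F_nonneg by (intro lamperti_matrix_ratio_tendsto_0) auto
  obtain \<delta> where \<delta>: "\<And>j. \<delta> j > 0" "\<And>j. (\<lambda>i. \<delta> i * K i j) sums \<delta> j"
    using invariant_measure_of_green_function[of K g, OF K_pos g_nonneg green ratio] by blast
  \<comment> \<open>Undoing the index shift: the measure on states from 1 on is
    \<open>\<delta> (j - 1)\<close>.\<close>
  have bij: "bij_betw Suc UNIV {1..}"
    by (rule bij_betwI[of _ _ _ "\<lambda>n. n - 1"]) auto
  have "((\<lambda>i. \<delta> (i - 1) * lamperti_matrix F i j) has_sum \<delta> (j - 1)) {1..}" if "j \<ge> 1" for j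
  proof -
    have "((\<lambda>i. \<delta> i * K i (j - 1)) has_sum \<delta> (j - 1)) UNIV"
      using \<delta>(2)[of "j - 1"] \<delta>(1) K_pos
      by (intro sums_nonneg_imp_has_sum) (auto simp: less_imp_le)
    then have "((\<lambda>i. \<delta> (Suc i - 1) * lamperti_matrix F (Suc i) j) has_sum \<delta> (j - 1)) UNIV"
      using that by (simp add: K_def)
    then show ?thesis
      by (rule iffD1[OF has_sum_reindex_bij_betw[OF bij]])
  qed
  then show ?thesis using \<delta>(1) by (intro exI[of _ "\<lambda>j. \<delta> (j - 1)"]) auto
qed

end
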